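(* Let $\varPhi$ be a finite simply-laced root system spanning $E$, let $\tau_1,\dots,\tau_l\in\varPhi$ be linearly independent roots with diagram $\Gamma\in\mathsf{C4}\cup\mathsf{DE4}$, $L$ their span, and $M$ the orthogonal complement of $L$ in $E$. Let $\gamma\in\varPhi$, $\gamma=\gamma_L+\mu$ with $\gamma_L\in L$, $\mu\in M$, and let $\gamma^{\vee}$ be its linkage labels vector. 1) $\gamma^{\vee}=B_L\gamma_L$. 2) For each $i$, $B_Ls_{\tau_i}=s^*_{\tau_i}B_L$ on $L$, and $(s_{\tau_i}\gamma)^{\vee}=s^*_{\tau_i}B_L\gamma_L=s^*_{\tau_i}\gamma^{\vee}$. 3) For $w\in W_L$ and its dual element $w^*:={}^t w^{-1}\in W_L^{\vee}$, $(w\gamma)^{\vee}=w^*\gamma^{\vee}$. 4) $\mathscr{B}_L(s_{\tau_i}v)=\mathscr{B}_L(v)$ for any $v\in L$, and $\mathscr{B}^{\vee}_L(s^*_{\tau_i}u)=\mathscr{B}^{\vee}_L(u)$ for any $u\in L^{\vee}$.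
   Context: Roots are normalized by $(\alpha,\alpha)=2$. A set of linearly independent roots has as diagram the graph with a solid edge when the inner product is $-1$ and a dotted edge when it is $+1$; a simply-laced Carter diagram is such a diagram all of whose cycles have even length. $\mathsf{C4}$ is the class of connected simply-laced Carter diagrams containing as subdiagram the 4-cycle $D_4(a_1)$ with an odd number of dotted edges; $\mathsf{DE4}=\{E_6,E_7,E_8,D_l\ (l\ge4)\}$. $B_L=((\tau_i,\tau_j))$ is viewed as a linear map $L\to L^{\vee}$ into the dual space, with $\langle B_Lu,v\rangle=(u,v)$; elements of $L^{\vee}$ are identified with vectors in $\mathbb{R}^l$ via values on $\tau_1,\dots,\tau_l$. For $\gamma\in E$, $\gamma^{\vee}=((\gamma,\tau_1),\dots,(\gamma,\tau_l))^t\in L^{\vee}$. $s_{\tau_i}$ is the reflection in $\tau_i$; $s^*_{\tau_i}u=u-\langle u,\tau_i\rangle B_L\tau_i$ on $L^{\vee}$. $W_L$ is generated by the $s_{\tau_i}$ and $W_L^{\vee}$ by the $s^*_{\tau_i}$; the transpose ${}^tw$ on $L^{\vee}$ is defined by $\langle{}^twu,v\rangle=\langle u,wv\rangle$, $v\in L$. $\mathscr{B}_L(v)=\langle B_Lv,v\rangle$ and $\mathscr{B}^{\vee}_L(u)=\langle u,B_L^{-1}u\rangle$. *)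

theory Defs
  imports "HOL-Analysis.Analysis" "HOL-Algebra.Generated_Groups" "HOL-Algebra.Bij"
begin

section \<open>Simply-laced root systems\<close>

definition reflection :: "'a::real_inner \<Rightarrow> 'a \<Rightarrow> 'a" where
  "reflection a x = x - (2 * (x \<bullet> a) / (a \<bullet> a)) *\<^sub>R a"

definition root_system :: "'a::euclidean_space set \<Rightarrow> bool" where
  "root_system \<Phi> \<longleftrightarrow>
     finite \<Phi> \<and> 0 \<notin> \<Phi> \<and> span \<Phi> = UNIV \<and>
     (\<forall>a\<in>\<Phi>. \<forall>c. c *\<^sub>R a \<in> \<Phi> \<longleftrightarrow> c = 1 \<or> c = -1) \<and>
     (\<forall>a\<in>\<Phi>. \<forall>b\<in>\<Phi>. reflection a b \<in> \<Phi>) \<and>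
     (\<forall>a\<in>\<Phi>. \<forall>b\<in>\<Phi>. 2 * (b \<bullet> a) / (a \<bullet> a) \<in> \<int>)"

text \<open>Simply-laced means that all roots have the same length; the normalization
  \<open>(\<alpha>, \<alpha>) = 2\<close> is built in. Irreducibility is not required.\<close>

definition simply_laced_root_system :: "'a::euclidean_space set \<Rightarrow> bool" where
  "simply_laced_root_system \<Phi> \<longleftrightarrow> root_system \<Phi> \<and> (\<forall>a\<in>\<Phi>. a \<bullet> a = 2)"

definition lin_indep_family :: "('n \<Rightarrow> 'a::real_vector) \<Rightarrow> bool" where
  "lin_indep_family \<tau> \<longleftrightarrow> inj \<tau> \<and> independent (range \<tau>)"


section \<open>Diagrams\<close>

datatype 'v diagram = Diagram (solid: "'v \<Rightarrow> 'v \<Rightarrow> bool") (dotted: "'v \<Rightarrow> 'v \<Rightarrow> bool")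

definition adj :: "'v diagram \<Rightarrow> 'v \<Rightarrow> 'v \<Rightarrow> bool" where
  "adj \<Gamma> x y \<longleftrightarrow> solid \<Gamma> x y \<or> dotted \<Gamma> x y"

definition diagram_of :: "('n \<Rightarrow> 'a::real_inner) \<Rightarrow> 'n diagram" where
  "diagram_of \<tau> = Diagram (\<lambda>i j. \<tau> i \<bullet> \<tau> j = -1) (\<lambda>i j. \<tau> i \<bullet> \<tau> j = 1)"

definition closed_edges :: "'v list \<Rightarrow> ('v \<times> 'v) list" where
  "closed_edges vs = zip vs (rotate1 vs)"

definition is_cycle :: "'v diagram \<Rightarrow> 'v list \<Rightarrow> bool" where
  "is_cycle \<Gamma> vs \<longleftrightarrow>
     length vs \<ge> 3 \<and> distinct vs \<and> (\<forall>(x, y) \<in> set (closed_edges vs). adj \<Gamma> x y)"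

definition connected_diagram :: "'v diagram \<Rightarrow> bool" where
  "connected_diagram \<Gamma> \<longleftrightarrow> (\<forall>x y. (adj \<Gamma>)\<^sup>*\<^sup>* x y)"

definition simply_laced_Carter_diagrams :: "'a::euclidean_space set \<Rightarrow> 'n diagram set" where
  "simply_laced_Carter_diagrams \<Phi> =
     {\<Gamma>. (\<exists>\<tau>. range \<tau> \<subseteq> \<Phi> \<and> lin_indep_family \<tau> \<and> \<Gamma> = diagram_of \<tau>) \<and>
         (\<forall>vs. is_cycle \<Gamma> vs \<longrightarrow> even (length vs))}"

text \<open>The 4-cycle below is automatically an induced subdiagram: a chord would give a
  3-cycle, which is excluded because all cycles are even.\<close>

definition class_C4 :: "'a::euclidean_space set \<Rightarrow> 'n diagram set" where
  "class_C4 \<Phi> =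
     {\<Gamma> \<in> simply_laced_Carter_diagrams \<Phi>.
        connected_diagram \<Gamma> \<and>
        (\<exists>vs. is_cycle \<Gamma> vs \<and> length vs = 4 \<and>
              odd (length (filter (\<lambda>(x, y). dotted \<Gamma> x y) (closed_edges vs))))}"

text \<open>The tree with solid edges on \<open>{0..<l}\<close> consisting of the path
  \<open>0, 1, \<dots>, l - 2\<close> and the vertex \<open>l - 1\<close> attached to \<open>b\<close>. It is \<open>D\<^sub>l\<close> for
  \<open>b = l - 3\<close> and \<open>E\<^sub>l\<close> for \<open>b = 2\<close>.\<close>

definition branched_path_edge :: "nat \<Rightarrow> nat \<Rightarrow> nat \<Rightarrow> nat \<Rightarrow> bool" where
  "branched_path_edge l b i j \<longleftrightarrow> (j = Suc i \<and> j \<le> l - 2) \<or> (i = b \<and> j = l - 1)"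

definition branched_path :: "nat \<Rightarrow> nat \<Rightarrow> nat diagram" where
  "branched_path l b =
     Diagram (\<lambda>i j. branched_path_edge l b i j \<or> branched_path_edge l b j i) (\<lambda>i j. False)"

definition diagram_iso :: "'v diagram \<Rightarrow> nat \<Rightarrow> nat diagram \<Rightarrow> bool" where
  "diagram_iso \<Gamma> l \<Delta> \<longleftrightarrow>
     (\<exists>f. bij_betw f UNIV {0..<l} \<and>
          (\<forall>x y. (solid \<Gamma> x y \<longleftrightarrow> solid \<Delta> (f x) (f y)) \<and>
                 (dotted \<Gamma> x y \<longleftrightarrow> dotted \<Delta> (f x) (f y))))"

definition class_DE4 :: "'n diagram set" where
  "class_DE4 =
     {\<Gamma>. (\<exists>l\<in>{6, 7, 8}. diagram_iso \<Gamma> l (branched_path l 2)) \<or>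
         (\<exists>l\<ge>4. diagram_iso \<Gamma> l (branched_path l (l - 3)))}"


section \<open>The space spanned by the roots and its dual\<close>

text \<open>\<open>L\<close> is the subspace \<open>span (range \<tau>)\<close>. A functional on \<open>L\<close> is identified with the
  vector in \<open>real ^ 'n\<close> of its values on the \<open>\<tau> i\<close>.\<close>

definition dual_vec :: "('n::finite \<Rightarrow> 'a) \<Rightarrow> ('a \<Rightarrow> real) \<Rightarrow> real ^ 'n" where
  "dual_vec \<tau> f = (\<chi> i. f (\<tau> i))"

definition coords :: "('n::finite \<Rightarrow> 'a::real_vector) \<Rightarrow> 'a \<Rightarrow> real ^ 'n" where
  "coords \<tau> v = (\<chi> i. representation (range \<tau>) v (\<tau> i))"

definition pairing :: "('n::finite \<Rightarrow> 'a::real_vector) \<Rightarrow> real ^ 'n \<Rightarrow> 'a \<Rightarrow> real" where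
  "pairing \<tau> u v = u \<bullet> coords \<tau> v"

definition gram :: "('n::finite \<Rightarrow> 'a::real_inner) \<Rightarrow> real ^ 'n ^ 'n" where
  "gram \<tau> = (\<chi> i j. \<tau> i \<bullet> \<tau> j)"

definition B_map :: "('n::finite \<Rightarrow> 'a::real_inner) \<Rightarrow> 'a \<Rightarrow> real ^ 'n" where
  "B_map \<tau> v = gram \<tau> *v coords \<tau> v"

definition B_inv :: "('n::finite \<Rightarrow> 'a::real_inner) \<Rightarrow> real ^ 'n \<Rightarrow> 'a" where
  "B_inv \<tau> = inv_into (span (range \<tau>)) (B_map \<tau>)"

definition linkage_labels :: "('n::finite \<Rightarrow> 'a::real_inner) \<Rightarrow> 'a \<Rightarrow> real ^ 'n" where
  "linkage_labels \<tau> \<gamma> = (\<chi> i. \<gamma> \<bullet> \<tau> i)"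

definition dual_reflection ::
    "('n::finite \<Rightarrow> 'a::real_inner) \<Rightarrow> 'n \<Rightarrow> real ^ 'n \<Rightarrow> real ^ 'n" where
  "dual_reflection \<tau> i u = u - pairing \<tau> u (\<tau> i) *\<^sub>R B_map \<tau> (\<tau> i)"

text \<open>\<open>u \<mapsto> u \<circ> w\<close> on functionals, for \<open>w\<close> a map preserving \<open>L\<close>.\<close>

definition dual_transpose ::
    "('n::finite \<Rightarrow> 'a::real_inner) \<Rightarrow> ('a \<Rightarrow> 'a) \<Rightarrow> real ^ 'n \<Rightarrow> real ^ 'n" where
  "dual_transpose \<tau> w u = dual_vec \<tau> (\<lambda>v. pairing \<tau> u (w v))"

definition W_L :: "('n::finite \<Rightarrow> 'a::real_inner) \<Rightarrow> ('a \<Rightarrow> 'a) set" where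
  "W_L \<tau> = generate (BijGroup UNIV) (range (\<lambda>i. reflection (\<tau> i)))"

definition W_L_dual :: "('n::finite \<Rightarrow> 'a::real_inner) \<Rightarrow> (real ^ 'n \<Rightarrow> real ^ 'n) set" where
  "W_L_dual \<tau> = generate (BijGroup UNIV) (range (dual_reflection \<tau>))"

definition quad_form :: "('n::finite \<Rightarrow> 'a::real_inner) \<Rightarrow> 'a \<Rightarrow> real" where
  "quad_form \<tau> v = pairing \<tau> (B_map \<tau> v) v"

definition dual_quad_form :: "('n::finite \<Rightarrow> 'a::real_inner) \<Rightarrow> real ^ 'n \<Rightarrow> real" where
  "dual_quad_form \<tau> u = pairing \<tau> u (B_inv \<tau> u)"


section \<open>Characteristic properties of the pairing, the form and the transpose\<close>

lemma sum_coords: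
  fixes \<tau> :: "'n::finite \<Rightarrow> 'a::real_vector"
  assumes "lin_indep_family \<tau>" "v \<in> span (range \<tau>)"
  shows "(\<Sum>i\<in>UNIV. (coords \<tau> v $ i) *\<^sub>R \<tau> i) = v"
proof -
  have inj: "inj \<tau>" and ind: "independent (range \<tau>)"
    using assms(1) by (auto simp: lin_indep_family_def)
  have "(\<Sum>i\<in>UNIV. (coords \<tau> v $ i) *\<^sub>R \<tau> i)
      = (\<Sum>b\<in>range \<tau>. representation (range \<tau>) v b *\<^sub>R b)"
    by (simp add: coords_def sum.reindex[OF inj])
  also have "\<dots> = v"
    by (rule real_vector.sum_representation_eq[OF ind assms(2)]) auto
  finally show ?thesis .
qed

lemma pairing_dual_vec:
  fixes \<tau> :: "'n::finite \<Rightarrow> 'a::real_vector"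
  assumes "lin_indep_family \<tau>" "linear f" "v \<in> span (range \<tau>)"
  shows "pairing \<tau> (dual_vec \<tau> f) v = f v"
proof -
  have "f v = f (\<Sum>i\<in>UNIV. (coords \<tau> v $ i) *\<^sub>R \<tau> i)"
    using sum_coords[OF assms(1,3)] by simp
  also have "\<dots> = (\<Sum>i\<in>UNIV. (coords \<tau> v $ i) * f (\<tau> i))"
    by (simp add: linear_sum[OF assms(2)] linear_cmul[OF assms(2)])
  finally show ?thesis
    by (simp add: pairing_def dual_vec_def inner_vec_def mult.commute)
qed

lemma B_map_eq:
  fixes \<tau> :: "'n::finite \<Rightarrow> 'a::real_inner"
  assumes "lin_indep_family \<tau>" "v \<in> span (range \<tau>)"
  shows "B_map \<tau> v = dual_vec \<tau> (\<lambda>x. v \<bullet> x)"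
proof -
  have "v \<bullet> \<tau> i = (\<Sum>j\<in>UNIV. \<tau> i \<bullet> \<tau> j * coords \<tau> v $ j)" for i
  proof -
    have "v \<bullet> \<tau> i = (\<Sum>j\<in>UNIV. (coords \<tau> v $ j) *\<^sub>R \<tau> j) \<bullet> \<tau> i"
      using sum_coords[OF assms] by simp
    also have "\<dots> = (\<Sum>j\<in>UNIV. \<tau> i \<bullet> \<tau> j * coords \<tau> v $ j)"
      unfolding inner_sum_left by (intro sum.cong) (simp_all add: inner_commute)
    finally show ?thesis .
  qed
  then show ?thesis
    by (simp add: B_map_def gram_def dual_vec_def matrix_vector_mult_def vec_eq_iff)
qed

lemma pairing_B_map:
  fixes \<tau> :: "'n::finite \<Rightarrow> 'a::real_inner"
  assumes "lin_indep_family \<tau>" "u \<in> span (range \<tau>)" "v \<in> span (range \<tau>)"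
  shows "pairing \<tau> (B_map \<tau> u) v = u \<bullet> v"
  using pairing_dual_vec[OF assms(1) _ assms(3), of "\<lambda>x. u \<bullet> x"]
  by (simp add: B_map_eq[OF assms(1,2)] linear_iff inner_add_right)

lemma coords_sum:
  fixes \<tau> :: "'n::finite \<Rightarrow> 'a::real_vector"
  assumes "lin_indep_family \<tau>"
  shows "coords \<tau> (\<Sum>i\<in>UNIV. (x $ i) *\<^sub>R \<tau> i) = x"
proof -
  have inj: "inj \<tau>" and ind: "independent (range \<tau>)"
    using assms by (auto simp: lin_indep_family_def)
  have "representation (range \<tau>) (\<Sum>i\<in>UNIV. (x $ i) *\<^sub>R \<tau> i) (\<tau> j) = x $ j" for j
  proof -
    have "representation (range \<tau>) (\<Sum>i\<in>UNIV. (x $ i) *\<^sub>R \<tau> i) (\<tau> j)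
        = (\<Sum>i\<in>UNIV. x $ i * (if \<tau> j = \<tau> i then 1 else 0))"
      by (simp add: real_vector.representation_sum[OF ind] span_base span_scale
            real_vector.representation_scale[OF ind] real_vector.representation_basis[OF ind])
    also have "\<dots> = (\<Sum>i\<in>UNIV. if i = j then x $ i else 0)"
      by (rule sum.cong) (auto simp: inj_eq[OF inj])
    finally show ?thesis by simp
  qed
  then show ?thesis by (simp add: coords_def vec_eq_iff)
qed

lemma linear_coords_sum:
  fixes \<tau> :: "'n::finite \<Rightarrow> 'a::real_vector"
  assumes ind: "independent (range \<tau>)" and x: "x \<in> span (range \<tau>)" and y: "y \<in> span (range \<tau>)"
  shows "coords \<tau> (x + y) = coords \<tau> x + coords \<tau> y"
    and "coords \<tau> (c *\<^sub>R x) = c *\<^sub>R coords \<tau> x"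
    and "coords \<tau> (x - y) = coords \<tau> x - coords \<tau> y"
  using x y by (simp_all add: coords_def vec_eq_iff real_vector.representation_add[OF ind]
      real_vector.representation_scale[OF ind] real_vector.representation_diff[OF ind])

lemma pairing_dual_transpose:
  fixes \<tau> :: "'n::finite \<Rightarrow> 'a::real_inner"
  assumes "lin_indep_family \<tau>" "linear w" "w ` span (range \<tau>) \<subseteq> span (range \<tau>)"
    and "v \<in> span (range \<tau>)"
  shows "pairing \<tau> (dual_transpose \<tau> w u) v = pairing \<tau> u (w v)"
proof -
  have ind: "independent (range \<tau>)" using assms(1) by (simp add: lin_indep_family_def)
  have w: "w (\<tau> i) \<in> span (range \<tau>)" for i using assms(3) by (auto simp: span_base)
  have "w v = (\<Sum>i\<in>UNIV. (coords \<tau> v $ i) *\<^sub>R w (\<tau> i))"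
    using arg_cong[OF sum_coords[OF assms(1,4)], of w]
    by (simp add: linear_sum[OF assms(2)] linear_cmul[OF assms(2)])
  then have "coords \<tau> (w v) = (\<Sum>i\<in>UNIV. (coords \<tau> v $ i) *\<^sub>R coords \<tau> (w (\<tau> i)))"
    using w by (simp add: coords_def vec_eq_iff real_vector.representation_sum[OF ind] span_scale
        real_vector.representation_scale[OF ind])
  then show ?thesis
    unfolding pairing_def dual_transpose_def dual_vec_def
    by (simp add: inner_vec_def[of "vec_lambda _"] inner_sum_right mult.commute)
qed

lemma bij_betw_B_map:
  fixes \<tau> :: "'n::finite \<Rightarrow> 'a::real_inner"
  assumes li: "lin_indep_family \<tau>"
  shows "bij_betw (B_map \<tau>) (span (range \<tau>)) UNIV"
proof -
  have ind: "independent (range \<tau>)" using li by (simp add: lin_indep_family_def)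
  have zero: "v = 0" if "v \<in> span (range \<tau>)" "B_map \<tau> v = 0" for v
    using pairing_B_map[OF li that(1) that(1)] that(2) by (simp add: pairing_def)
  have inj: "inj_on (B_map \<tau>) (span (range \<tau>))"
  proof (rule inj_onI)
    fix x y assume xy: "x \<in> span (range \<tau>)" "y \<in> span (range \<tau>)" "B_map \<tau> x = B_map \<tau> y"
    then have "B_map \<tau> (x - y) = 0"
      by (simp add: B_map_def linear_coords_sum[OF ind] matrix_vector_mult_diff_distrib)
    with zero[OF span_diff[OF xy(1,2)]] show "x = y" by simp
  qed
  let ?c = "\<lambda>x::real^'n. \<Sum>i\<in>UNIV. (x $ i) *\<^sub>R \<tau> i"
  have c: "?c x \<in> span (range \<tau>)" for x
    by (intro span_sum span_scale span_base) auto
  have "inj ((*v) (gram \<tau>))"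
  proof (rule injI)
    fix x y assume "gram \<tau> *v x = gram \<tau> *v y"
    then have "B_map \<tau> (?c x) = B_map \<tau> (?c y)"
      by (simp add: B_map_def coords_sum[OF li])
    then have "?c x = ?c y" using inj c by (auto dest: inj_onD)
    then show "x = y" using coords_sum[OF li] by metis
  qed
  then have "surj ((*v) (gram \<tau>))"
    by (rule linear_inj_imp_surj[OF matrix_vector_mul_linear])
  then have "u \<in> B_map \<tau> ` span (range \<tau>)" for u
  proof -
    obtain x where "u = gram \<tau> *v x" using \<open>surj _\<close> by (metis surjD)
    then have "u = B_map \<tau> (?c x)" by (simp add: B_map_def coords_sum[OF li])
    then show ?thesis using c by blast
  qed
  with inj show ?thesis by (auto simp: bij_betw_def)
qed

end

theory Submission
  imports Defs
begin

text \<open>Every functional on \<open>L\<close> is the linkage labels vector of some \<open>x \<in> L\<close>, and the pairing of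
  the labels of \<open>x\<close> with \<open>v \<in> L\<close> is just \<open>x \<bullet> v\<close>. Hence the contragredient of an
  orthogonal \<open>w\<close> preserving \<open>L\<close> is determined by sending the labels of \<open>x\<close> to those of
  \<open>w x\<close>, and every identity on the dual side becomes one about the inner product.\<close>

lemma reflection_inner_left:
  "reflection a x \<bullet> y = x \<bullet> y - 2 * (x \<bullet> a) / (a \<bullet> a) * (a \<bullet> y)"
  by (simp add: reflection_def inner_diff_left)

lemma orthogonal_transformation_reflection: "orthogonal_transformation (reflection a)"
proof -
  have "linear (reflection a)"
    unfolding linear_iff reflection_def
    by (simp add: inner_add_left distrib_left add_divide_distrib scaleR_left_distrib
        scaleR_right_diff_distrib mult.left_commute)
  moreover have "reflection a v \<bullet> reflection a w = v \<bullet> w" for v w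
  \<comment> \<open>Division by zero yields 0, so \<open>reflection 0\<close> is the identity and is
    covered too.\<close>
  proof (cases "a = 0")
    case False
    then have "a \<bullet> a \<noteq> 0" by simp
    moreover have "a \<bullet> w = w \<bullet> a" by (rule inner_commute)
    ultimately show ?thesis
      by (simp add: reflection_def inner_diff_left inner_diff_right)
  qed (simp add: reflection_def)
  ultimately show ?thesis by (simp add: orthogonal_transformation_def)
qed

lemma reflection_reflection: "reflection a (reflection a x) = x"
proof (cases "a = 0")
  case False
  then have "reflection a x \<bullet> a = - (x \<bullet> a)" by (simp add: reflection_inner_left)
  \<comment> \<open>Only the outer reflection is unfolded at first, so that the sign change just
    obtained applies to the inner one.\<close>
  then show ?thesis by (simp add: reflection_def[of a "reflection a x"]) (simp add: reflection_def)
qed (simp add: reflection_def)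

lemma inv_reflection: "inv_into UNIV (reflection a) = reflection a"
  by (rule inv_equality) (simp_all add: reflection_reflection)

lemma reflection_in_span: "a \<in> S \<Longrightarrow> x \<in> span S \<Longrightarrow> reflection a x \<in> span S"
  by (simp add: reflection_def span_diff span_scale span_base)

text \<open>The operations of \<open>BijGroup\<close> are restricted functions. Over
  \<open>UNIV\<close> the restriction of arguments is void, and bijectivity puts the factors in the
  carrier, so this and the next two facts recover the ordinary operations on functions.\<close>

lemma mult_BijGroup_UNIV: "bij f \<Longrightarrow> bij g \<Longrightarrow> f \<otimes>\<^bsub>BijGroup UNIV\<^esub> g = f \<circ> g"
  by (auto simp: BijGroup_def Bij_def compose_def fun_eq_iff)

lemma one_BijGroup_UNIV: "\<one>\<^bsub>BijGroup UNIV\<^esub> = id"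
  by (auto simp: BijGroup_def fun_eq_iff)

lemma inv_BijGroup_UNIV: "bij f \<Longrightarrow> inv\<^bsub>BijGroup UNIV\<^esub> f = inv_into UNIV f"
  by (simp add: inv_BijGroup Bij_def fun_eq_iff)

text \<open>The component orthogonal to L has inner product 0 with every \<open>\<tau> i\<close>, so
  the labels see only the component in L.\<close>

lemma linkage_labels_eq_B_map:
  assumes "lin_indep_family \<tau>" "x \<in> span (range \<tau>)" "y \<in> (span (range \<tau>))\<^sup>\<bottom>"
  shows "linkage_labels \<tau> (x + y) = B_map \<tau> x"
proof -
  have "y \<bullet> \<tau> i = 0" for i
    using assms(3) by (auto simp: orthogonal_comp_def orthogonal_def span_base inner_commute)
  then show ?thesis
    by (simp add: B_map_eq[OF assms(1,2)] linkage_labels_def dual_vec_def inner_add_left)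
qed

lemma linkage_labels_span:
  "lin_indep_family \<tau> \<Longrightarrow> x \<in> span (range \<tau>) \<Longrightarrow> linkage_labels \<tau> x = B_map \<tau> x"
  by (simp add: B_map_eq linkage_labels_def dual_vec_def)

text \<open>The labels are the values at the \<open>\<tau> i\<close> of the functional given by
  inner product with x. Here x may lie outside L, so later results apply to \<open>\<gamma>\<close>
  itself and not only to \<open>\<gamma>\<^sub>L\<close>.\<close>

lemma pairing_linkage_labels:
  fixes \<tau> :: "'n::finite \<Rightarrow> 'a::real_inner"
  assumes "lin_indep_family \<tau>" "v \<in> span (range \<tau>)"
  shows "pairing \<tau> (linkage_labels \<tau> x) v = x \<bullet> v"
  using pairing_dual_vec[OF assms(1) _ assms(2), of "\<lambda>v. x \<bullet> v"]
  by (simp add: linkage_labels_def dual_vec_def linear_iff inner_add_right)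

text \<open>The inner product is nondegenerate on L, which makes \<open>B_map\<close> surjective
  from L. Choosing x in L matters for the dual quadratic form.\<close>

lemma linkage_labels_cases:
  fixes \<tau> :: "'n::finite \<Rightarrow> 'a::real_inner"
  assumes "lin_indep_family \<tau>"
  obtains x where "x \<in> span (range \<tau>)" "u = linkage_labels \<tau> x"
proof -
  have "u \<in> B_map \<tau> ` span (range \<tau>)"
    by (simp add: bij_betw_imp_surj_on[OF bij_betw_B_map[OF assms]])
  then show thesis
    using that by (auto simp: linkage_labels_span[OF assms])
qed

text \<open>With squared length 2 the reflection subtracts
  \<open>(x \<bullet> \<tau> i) *\<^sub>R \<tau> i\<close>. Taking labels is linear, and the
  coefficient is exactly the pairing in \<open>dual_reflection\<close>.\<close>

lemma linkage_labels_reflection: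
  fixes \<tau> :: "'n::finite \<Rightarrow> 'a::real_inner"
  assumes "lin_indep_family \<tau>" "\<tau> i \<bullet> \<tau> i = 2"
  shows "linkage_labels \<tau> (reflection (\<tau> i) x) = dual_reflection \<tau> i (linkage_labels \<tau> x)"
proof -
  have "\<tau> i \<in> span (range \<tau>)" by (simp add: span_base)
  then have "dual_reflection \<tau> i (linkage_labels \<tau> x)
      = linkage_labels \<tau> x - (x \<bullet> \<tau> i) *\<^sub>R linkage_labels \<tau> (\<tau> i)"
    by (simp add: dual_reflection_def pairing_linkage_labels[OF assms(1)]
        linkage_labels_span[OF assms(1)])
  then show ?thesis
    by (simp add: linkage_labels_def vec_eq_iff reflection_inner_left assms(2))
qed

text \<open>Labels carry the reflection to its dual, which therefore inherits being an
  involution.\<close>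

lemma bij_dual_reflection:
  fixes \<tau> :: "'n::finite \<Rightarrow> 'a::real_inner"
  assumes "lin_indep_family \<tau>" "\<tau> i \<bullet> \<tau> i = 2"
  shows "bij (dual_reflection \<tau> i)"
proof (rule involuntory_imp_bij)
  fix u :: "real ^ 'n"
  obtain x where "u = linkage_labels \<tau> x" by (rule linkage_labels_cases[OF assms(1)])
  then show "dual_reflection \<tau> i (dual_reflection \<tau> i u) = u"
    by (simp add: reflection_reflection flip: linkage_labels_reflection[OF assms])
qed

text \<open>The adjoint of an orthogonal map is its inverse, so moving the inverse of w across the
  inner product turns x into \<open>w x\<close>. The condition on the span keeps the images of the
  \<open>\<tau> i\<close> in L, where the pairing is an inner product.\<close>

lemma dual_transpose_linkage_labels:
  fixes \<tau> :: "'n::finite \<Rightarrow> 'a::euclidean_space"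
  assumes "lin_indep_family \<tau>" "orthogonal_transformation w"
    and "inv_into UNIV w ` span (range \<tau>) \<subseteq> span (range \<tau>)"
  shows "dual_transpose \<tau> (inv_into UNIV w) (linkage_labels \<tau> x) = linkage_labels \<tau> (w x)"
proof -
  have "x \<bullet> inv_into UNIV w (\<tau> i) = w x \<bullet> \<tau> i" for i
    using orthogonal_transformation_surj[OF assms(2)] assms(2)
    by (metis orthogonal_transformation_def surj_f_inv_f)
  moreover have "inv_into UNIV w (\<tau> i) \<in> span (range \<tau>)" for i
    using assms(3) by (auto simp: span_base)
  ultimately show ?thesis
    by (simp add: dual_transpose_def dual_vec_def pairing_linkage_labels[OF assms(1)] vec_eq_iff)
       (simp add: linkage_labels_def)
qed

text \<open>A reflection is its own inverse, so the contragredient of a generator of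
  \<open>W_L\<close> is a generator of \<open>W_L_dual\<close>.\<close>

lemma dual_transpose_reflection:
  fixes \<tau> :: "'n::finite \<Rightarrow> 'a::euclidean_space"
  assumes "lin_indep_family \<tau>" "\<tau> i \<bullet> \<tau> i = 2"
  shows "dual_transpose \<tau> (reflection (\<tau> i)) = dual_reflection \<tau> i"
proof
  fix u :: "real ^ 'n"
  obtain x where "u = linkage_labels \<tau> x" by (rule linkage_labels_cases[OF assms(1)])
  moreover have "reflection (\<tau> i) ` span (range \<tau>) \<subseteq> span (range \<tau>)"
    by (auto intro: reflection_in_span)
  ultimately show "dual_transpose \<tau> (reflection (\<tau> i)) u = dual_reflection \<tau> i u"
    using dual_transpose_linkage_labels
      [OF assms(1) orthogonal_transformation_reflection[of "\<tau> i"]]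
    by (simp add: inv_reflection linkage_labels_reflection[OF assms])
qed

text \<open>Needed to read products in \<open>W_L_dual\<close> as compositions, since
  \<open>BijGroup\<close> multiplies only bijections that way.\<close>

lemma bij_W_L_dual:
  fixes \<tau> :: "'n::finite \<Rightarrow> 'a::real_inner"
  assumes "lin_indep_family \<tau>" "\<And>i. \<tau> i \<bullet> \<tau> i = 2" "f \<in> W_L_dual \<tau>"
  shows "bij f"
proof -
  have "range (dual_reflection \<tau>) \<subseteq> carrier (BijGroup UNIV)"
    using bij_dual_reflection[OF assms(1,2)] by (auto simp: BijGroup_def Bij_def)
  then have "f \<in> carrier (BijGroup UNIV)"
    using group.generate_incl[OF group_BijGroup] assms(3) unfolding W_L_dual_def by blast
  then show ?thesis by (simp add: BijGroup_def Bij_def)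
qed

text \<open>Induction on the generation of w. The three claims go together: for a product,
  membership in the dual group rests on orthogonality and on invariance of L for both
  factors.\<close>

lemma W_L_orthogonal_and_dual:
  fixes \<tau> :: "'n::finite \<Rightarrow> 'a::euclidean_space"
  assumes li: "lin_indep_family \<tau>" and norm: "\<And>i. \<tau> i \<bullet> \<tau> i = 2" and "w \<in> W_L \<tau>"
  shows "orthogonal_transformation w \<and> inv_into UNIV w ` span (range \<tau>) \<subseteq> span (range \<tau>)
    \<and> dual_transpose \<tau> (inv_into UNIV w) \<in> W_L_dual \<tau>"
  using assms(3) unfolding W_L_def
proof (induction w rule: generate.induct)
  case one
  have "dual_transpose \<tau> id = id"
  proof
    fix u :: "real ^ 'n"
    obtain x where "u = linkage_labels \<tau> x" by (rule linkage_labels_cases[OF li])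
    then show "dual_transpose \<tau> id u = id u"
      using dual_transpose_linkage_labels[OF li, of id x]
      by (simp add: id_def inv_id[unfolded id_def] orthogonal_transformation_id)
  qed
  then show ?case
    using generate.one[of "BijGroup UNIV" "range (dual_reflection \<tau>)"]
    by (simp add: one_BijGroup_UNIV W_L_dual_def) (simp add: id_def orthogonal_transformation_id)
next
  case (incl h)
  then show ?case
    by (auto simp: W_L_dual_def inv_reflection orthogonal_transformation_reflection
        dual_transpose_reflection[OF li norm] reflection_in_span intro: generate.incl)
next
  case (inv h)
  then obtain i where h: "h = reflection (\<tau> i)" by auto
  \<comment> \<open>Generators are involutions, so this case reduces to that of a generator.\<close>
  have "inv\<^bsub>BijGroup UNIV\<^esub> h = h"
    by (simp add: h inv_BijGroup_UNIV inv_reflection orthogonal_transformation_bij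
        orthogonal_transformation_reflection)
  then show ?case
    by (auto simp: h W_L_dual_def inv_reflection orthogonal_transformation_reflection
        dual_transpose_reflection[OF li norm] reflection_in_span intro: generate.incl)
next
  case (eng f g)
  have bij: "bij f" "bij g" using eng.IH by (auto simp: orthogonal_transformation_bij)
  have inv: "inv_into UNIV (f \<circ> g) = inv_into UNIV g \<circ> inv_into UNIV f"
    using bij by (rule o_inv_distrib)
  have orth: "orthogonal_transformation (f \<circ> g)"
    using eng.IH by (simp add: orthogonal_transformation_compose)
  have sub: "inv_into UNIV (f \<circ> g) ` span (range \<tau>) \<subseteq> span (range \<tau>)"
    using eng.IH unfolding inv by auto
  \<comment> \<open>Inversion and transposition each reverse the order, so together they preserve
    it. On labels of x both sides give the labels of \<open>f (g x)\<close>.\<close>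
  have "dual_transpose \<tau> (inv_into UNIV (f \<circ> g))
      = dual_transpose \<tau> (inv_into UNIV f) \<circ> dual_transpose \<tau> (inv_into UNIV g)"
  proof
    fix u :: "real ^ 'n"
    obtain x where "u = linkage_labels \<tau> x" by (rule linkage_labels_cases[OF li])
    then show "dual_transpose \<tau> (inv_into UNIV (f \<circ> g)) u
        = (dual_transpose \<tau> (inv_into UNIV f) \<circ> dual_transpose \<tau> (inv_into UNIV g)) u"
      using eng.IH orth sub by (simp add: dual_transpose_linkage_labels[OF li])
  qed
  also have "\<dots> = dual_transpose \<tau> (inv_into UNIV f) \<otimes>\<^bsub>BijGroup UNIV\<^esub>
      dual_transpose \<tau> (inv_into UNIV g)"
    using eng.IH by (simp add: mult_BijGroup_UNIV bij_W_L_dual[OF li norm])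
  also have "\<dots> \<in> W_L_dual \<tau>"
    using eng.IH unfolding W_L_dual_def by (intro generate.eng) auto
  finally show ?case
    using orth sub by (simp only: mult_BijGroup_UNIV[OF bij] simp_thms)
qed

lemma quad_form_eq:
  "lin_indep_family \<tau> \<Longrightarrow> v \<in> span (range \<tau>) \<Longrightarrow> quad_form \<tau> v = v \<bullet> v"
  by (simp add: quad_form_def pairing_B_map)

text \<open>For x in L, injectivity of \<open>B_map\<close> makes \<open>B_inv\<close> return x
  itself, and the pairing is then an inner product.\<close>

lemma dual_quad_form_linkage_labels:
  assumes "lin_indep_family \<tau>" "x \<in> span (range \<tau>)"
  shows "dual_quad_form \<tau> (linkage_labels \<tau> x) = x \<bullet> x"
  using assms bij_betw_imp_inj_on[OF bij_betw_B_map[OF assms(1)]]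
  by (simp add: dual_quad_form_def B_inv_def linkage_labels_span pairing_B_map)

theorem proposition2p8:
  fixes \<Phi> :: "'a::euclidean_space set"
    and \<tau> :: "'n::finite \<Rightarrow> 'a"
    and \<gamma> \<gamma>\<^sub>L \<mu> :: 'a
  assumes "simply_laced_root_system \<Phi>"
    and "range \<tau> \<subseteq> \<Phi>"
    and "lin_indep_family \<tau>"
    and "diagram_of \<tau> \<in> class_C4 \<Phi> \<union> class_DE4"
    and "\<gamma> \<in> \<Phi>"
    and "\<gamma> = \<gamma>\<^sub>L + \<mu>"
    and "\<gamma>\<^sub>L \<in> span (range \<tau>)"
    and "\<mu> \<in> (span (range \<tau>))\<^sup>\<bottom>"
  shows
    "linkage_labels \<tau> \<gamma> = B_map \<tau> \<gamma>\<^sub>L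
     \<and> (\<forall>i. (\<forall>v\<in>span (range \<tau>).
                B_map \<tau> (reflection (\<tau> i) v) = dual_reflection \<tau> i (B_map \<tau> v))
            \<and> linkage_labels \<tau> (reflection (\<tau> i) \<gamma>) = dual_reflection \<tau> i (B_map \<tau> \<gamma>\<^sub>L)
            \<and> dual_reflection \<tau> i (B_map \<tau> \<gamma>\<^sub>L) = dual_reflection \<tau> i (linkage_labels \<tau> \<gamma>))
     \<and> (\<forall>w\<in>W_L \<tau>.
            dual_transpose \<tau> (inv_into UNIV w) \<in> W_L_dual \<tau>
            \<and> linkage_labels \<tau> (w \<gamma>) = dual_transpose \<tau> (inv_into UNIV w) (linkage_labels \<tau> \<gamma>))
     \<and> (\<forall>i. (\<forall>v\<in>span (range \<tau>). quad_form \<tau> (reflection (\<tau> i) v) = quad_form \<tau> v)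
            \<and> (\<forall>u. dual_quad_form \<tau> (dual_reflection \<tau> i u) = dual_quad_form \<tau> u))"
proof (intro conjI allI ballI)
  note li = \<open>lin_indep_family \<tau>\<close>
  have norm: "\<tau> i \<bullet> \<tau> i = 2" for i
    using assms(1,2) by (auto simp: simply_laced_root_system_def)
  show lab: "linkage_labels \<tau> \<gamma> = B_map \<tau> \<gamma>\<^sub>L"
    using linkage_labels_eq_B_map[OF li assms(7,8)] assms(6) by simp
  fix i
  have refl: "reflection (\<tau> i) v \<in> span (range \<tau>)" if "v \<in> span (range \<tau>)" for v
    using that by (simp add: reflection_in_span)
  show "B_map \<tau> (reflection (\<tau> i) v) = dual_reflection \<tau> i (B_map \<tau> v)"
    if "v \<in> span (range \<tau>)" for v
    using linkage_labels_reflection[OF li norm] linkage_labels_span[OF li] refl that by metis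
  show "linkage_labels \<tau> (reflection (\<tau> i) \<gamma>) = dual_reflection \<tau> i (B_map \<tau> \<gamma>\<^sub>L)"
    and "dual_reflection \<tau> i (B_map \<tau> \<gamma>\<^sub>L) = dual_reflection \<tau> i (linkage_labels \<tau> \<gamma>)"
    by (simp_all add: linkage_labels_reflection[OF li norm] lab)
  have isom: "reflection (\<tau> i) v \<bullet> reflection (\<tau> i) v = v \<bullet> v" for v
    using orthogonal_transformation_reflection[of "\<tau> i"]
    by (simp add: orthogonal_transformation_def)
  show "quad_form \<tau> (reflection (\<tau> i) v) = quad_form \<tau> v" if "v \<in> span (range \<tau>)" for v
    using that by (simp add: quad_form_eq[OF li] refl isom)
  show "dual_quad_form \<tau> (dual_reflection \<tau> i u) = dual_quad_form \<tau> u" for u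
  proof -
    obtain x where "x \<in> span (range \<tau>)" "u = linkage_labels \<tau> x"
      by (rule linkage_labels_cases[OF li])
    \<comment> \<open>The dual reflection sends u to the labels of the reflected x, still in L, so
      invariance of the dual form is invariance of \<open>x \<bullet> x\<close>.\<close>
    then show ?thesis
      by (simp add: dual_quad_form_linkage_labels[OF li] refl isom
          flip: linkage_labels_reflection[OF li norm])
  qed
next
  note li = \<open>lin_indep_family \<tau>\<close>
  have norm: "\<tau> i \<bullet> \<tau> i = 2" for i
    using assms(1,2) by (auto simp: simply_laced_root_system_def)
  fix w assume "w \<in> W_L \<tau>"
  note w = W_L_orthogonal_and_dual[OF li norm this]
  show "dual_transpose \<tau> (inv_into UNIV w) \<in> W_L_dual \<tau>"
    using w by simp
  show "linkage_labels \<tau> (w \<gamma>) = dual_transpose \<tau> (inv_into UNIV w) (linkage_labels \<tau> \<gamma>)"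
    using w by (simp add: dual_transpose_linkage_labels[OF li])
qed

end
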